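(* Let $X,Y$ be complex Banach spaces, let $A_0,A_1\in\mathcal B(X,Y)$ and $A(z)=A_0+A_1z$. Let $0\le s<r\le\infty$ and suppose that the resolvent $R(z)=A(z)^{-1}\in\mathcal B(Y,X)$ is analytic for $z\in\mathcal U_{s,r}$, with Laurent series $R(z)=\sum_{j\in\mathbb Z}R_jz^j$ on $\mathcal U_{s,r}$. Let $P=R_{-1}A_1\in\mathcal B(X)$ and $P^c=I-P=R_0A_0\in\mathcal B(X)$ be the complementary key projections on the domain space, and let $Q=A_1R_{-1}\in\mathcal B(Y)$ and $Q^c=I-Q=A_0R_0\in\mathcal B(Y)$ be the corresponding complementary key projections on the range space. Let $X_s\subseteq X$ and $X_r\subseteq X$ be the respective generating subspaces for the infinite-length singular Jordan chains for $A(z)$ on $\mathcal U_{s,\infty}$ and the infinite-length regular Jordan chains for $A(z)$ on $\mathcal U_{0,r}$. Then: (i) $X_s=P(X)$ and $X_r=P^c(X)$, with $X=X_s\oplus X_r\cong X_s\times X_r$; and (ii) $Y_s:=Q(Y)=A_1(X_s)$ and $Y_r:=Q^c(Y)=A_0(X_r)$, with $Y=Y_s\oplus Y_r\cong Y_s\times Y_r$.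
   Context: For $0\le s<r\le\infty$, $\mathcal U_{s,r}=\{z\in\mathbb C\mid s<|z|<r\}$. $\mathcal B(X,Y)$ denotes the bounded linear operators from $X$ to $Y$, and $\mathcal B(X)=\mathcal B(X,X)$. That $R(z)$ is analytic on $\mathcal U_{s,r}$ means that for every $z\in\mathcal U_{s,r}$ the operator $A(z)$ has a bounded inverse $R(z)=A(z)^{-1}\in\mathcal B(Y,X)$ and $R$ is analytic there; hence $R(z)=\sum_{j\in\mathbb Z}R_jz^j$ with $R_j\in\mathcal B(Y,X)$ for all $z\in\mathcal U_{s,r}$. It is known that $P=R_{-1}A_1$ and $R_0A_0=I-P$ are complementary projections on $X$, and that $Q=A_1R_{-1}$ and $A_0R_0=I-Q$ are complementary projections on $Y$; they separate the bounded part ($|z|\le s$) and the unbounded part ($|z|\ge r$) of the spectral set of the pencil. An infinite-length singular Jordan chain for $A(z)$ on $\mathcal U_{s,\infty}$ generated by $x_{-1}$ is a sequence $\{x_{-n}\}_{n\in\mathbb N}\subseteq X$ (with $\mathbb N=\{1,2,\dots\}$) such that $A_0x_{-n}+A_1x_{-n-1}=0$ for all $n\in\mathbb N$ and $\lim_{n\to\infty}\|x_{-n}\|^{1/n}=s$. Its generating subspace is $$X_s=\{x_{-1}\in X\mid \text{there exists }\{x_{-n}\}_{n\in\mathbb N}\text{ with }A_0x_{-n}+A_1x_{-n-1}=0\ \text{for all } n\in\mathbb N\text{ and }\lim_{n\to\infty}\|x_{-n}\|^{1/n}=s\}.$$ An infinite-length regular Jordan chain for $A(z)$ on $\mathcal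 U_{0,r}$ generated by $x_1$ is defined analogously, and its generating subspace is $$X_r=\{x_1\in X\mid \text{there exists }\{x_n\}_{n\in\mathbb N}\text{ with }A_1x_n+A_0x_{n+1}=0\ \text{for all } n\in\mathbb N\text{ and }\lim_{n\to\infty}\|x_n\|^{1/n}=1/r\},$$ with the convention $1/\infty=0$.
   Formalization: The growth conditions lim ‖x_{-n}‖^{1/n} = s and lim ‖x_n‖^{1/n} = 1/r are replaced by limsup ≤ s and limsup ≤ 1/r; with exact limits the claim fails for s > 0 or r < ∞, since 0 is then not in X_s or X_r (e.g. A(z) = z − s on ℂ). *)

theory Defs
  imports "HOL-Analysis.Analysis"
begin

text \<open>
  HOL-Analysis has no class of complex normed spaces. The class below extends
  \<^class>\<open>real_normed_vector\<close> by a compatible complex scalar multiplication.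
\<close>

class scaleC =
  fixes scaleC :: "complex \<Rightarrow> 'a \<Rightarrow> 'a"  (infixr "*\<^sub>C" 75)

class complex_normed_vector = real_normed_vector + scaleC +
  assumes scaleC_add_right: "a *\<^sub>C (x + y) = a *\<^sub>C x + a *\<^sub>C y"
    and scaleC_add_left: "(a + b) *\<^sub>C x = a *\<^sub>C x + b *\<^sub>C x"
    and scaleC_scaleC: "a *\<^sub>C (b *\<^sub>C x) = (a * b) *\<^sub>C x"
    and scaleC_one: "1 *\<^sub>C x = x"
    and scaleR_scaleC: "t *\<^sub>R x = complex_of_real t *\<^sub>C x"
    and norm_scaleC: "norm (a *\<^sub>C x) = cmod a * norm x"

class complex_banach = complex_normed_vector + complete_space

subclass (in complex_banach) banach ..

global_interpretation complex_vector:
  vector_space "scaleC :: complex \<Rightarrow> 'a \<Rightarrow> 'a::complex_normed_vector"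
  by unfold_locales (rule scaleC_add_right scaleC_add_left scaleC_scaleC scaleC_one)+

instantiation complex :: complex_banach
begin

definition scaleC_complex :: "complex \<Rightarrow> complex \<Rightarrow> complex"
  where "scaleC_complex a x = a * x"

instance
  by standard (auto simp: scaleC_complex_def algebra_simps norm_mult scaleR_conv_of_real)

end

abbreviation clinear :: "('a::complex_normed_vector \<Rightarrow> 'b::complex_normed_vector) \<Rightarrow> bool"
  where "clinear \<equiv> Vector_Spaces.linear scaleC scaleC"

abbreviation csubspace :: "'a::complex_normed_vector set \<Rightarrow> bool"
  where "csubspace \<equiv> complex_vector.subspace"

text \<open>
  The type \<open>'a \<Rightarrow>\<^sub>L 'b\<close> consists of the bounded real-linear maps; it carries the operator norm.
  A bounded operator between complex spaces is an element \<open>T\<close> of it with \<open>clinear T\<close>. The complex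
  scalars act on the values.
\<close>

lemma bounded_linear_scaleC:
  "bounded_linear (\<lambda>x::'a::complex_normed_vector. c *\<^sub>C x)"
  by (rule bounded_linear_intro[where K = "cmod c"])
    (simp_all add: scaleC_add_right scaleR_scaleC scaleC_scaleC norm_scaleC mult.commute)

instantiation blinfun :: (real_normed_vector, complex_normed_vector) complex_normed_vector
begin

lift_definition scaleC_blinfun :: "complex \<Rightarrow> 'a \<Rightarrow>\<^sub>L 'b \<Rightarrow> 'a \<Rightarrow>\<^sub>L 'b"
  is "\<lambda>c T x. c *\<^sub>C T x"
  by (rule bounded_linear_compose[OF bounded_linear_scaleC])

instance
proof
  fix a b :: complex and t :: real and S T :: "'a \<Rightarrow>\<^sub>L 'b"
  show "a *\<^sub>C (S + T) = a *\<^sub>C S + a *\<^sub>C T"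
    by transfer (simp add: scaleC_add_right)
  show "(a + b) *\<^sub>C T = a *\<^sub>C T + b *\<^sub>C T"
    by transfer (simp add: scaleC_add_left)
  show "a *\<^sub>C (b *\<^sub>C T) = (a * b) *\<^sub>C T"
    by transfer (simp add: scaleC_scaleC)
  show "1 *\<^sub>C T = T"
    by transfer (simp add: scaleC_one)
  show "t *\<^sub>R T = complex_of_real t *\<^sub>C T"
    by transfer (simp add: scaleR_scaleC)
  have le: "norm (c *\<^sub>C U) \<le> cmod c * norm U" for c and U :: "'a \<Rightarrow>\<^sub>L 'b"
    by (rule norm_blinfun_bound)
      (simp_all add: scaleC_blinfun.rep_eq norm_scaleC mult.assoc mult_left_mono norm_blinfun)
  show "norm (a *\<^sub>C T) = cmod a * norm T"
  proof (cases "a = 0")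
    case True
    then show ?thesis using le[of 0 T] by simp
  next
    case False
    have "T = inverse a *\<^sub>C (a *\<^sub>C T)"
      using False by transfer (simp add: scaleC_scaleC scaleC_one)
    then have "norm T \<le> inverse (cmod a) * norm (a *\<^sub>C T)"
      using le[of "inverse a" "a *\<^sub>C T"] by (simp add: norm_inverse)
    then have "cmod a * norm T \<le> norm (a *\<^sub>C T)"
      using False by (simp add: field_simps)
    with le[of a T] show ?thesis by simp
  qed
qed

end

definition annulus :: "real \<Rightarrow> ereal \<Rightarrow> complex set"
  where "annulus s r = {z. s < cmod z \<and> ereal (cmod z) < r}"

text \<open>
  The library's \<open>analytic_on\<close> covers scalar-valued functions only; this is the same definition
  for functions with values in a complex normed space.
\<close>

definition vector_analytic_on :: "(complex \<Rightarrow> 'a::complex_normed_vector) \<Rightarrow> complex set \<Rightarrow> bool"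
  where "vector_analytic_on f S \<longleftrightarrow>
    (\<forall>z\<in>S. \<exists>e>0. \<forall>w\<in>ball z e. \<exists>D. (f has_derivative (\<lambda>h. h *\<^sub>C D)) (at w))"

definition pencil ::
    "('x::complex_normed_vector \<Rightarrow>\<^sub>L 'y::complex_normed_vector) \<Rightarrow> ('x \<Rightarrow>\<^sub>L 'y) \<Rightarrow> complex \<Rightarrow> 'x \<Rightarrow>\<^sub>L 'y"
  where "pencil A0 A1 z = A0 + z *\<^sub>C A1"

definition is_resolvent_on ::
    "('x::complex_normed_vector \<Rightarrow>\<^sub>L 'y::complex_normed_vector) \<Rightarrow> ('x \<Rightarrow>\<^sub>L 'y) \<Rightarrow>
      (complex \<Rightarrow> 'y \<Rightarrow>\<^sub>L 'x) \<Rightarrow> complex set \<Rightarrow> bool"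
  where "is_resolvent_on A0 A1 R S \<longleftrightarrow>
    (\<forall>z\<in>S. clinear (R z) \<and> R z o\<^sub>L pencil A0 A1 z = id_blinfun
      \<and> pencil A0 A1 z o\<^sub>L R z = id_blinfun)"

definition is_laurent_series_on ::
    "(int \<Rightarrow> 'a::complex_normed_vector) \<Rightarrow> (complex \<Rightarrow> 'a) \<Rightarrow> complex set \<Rightarrow> bool"
  where "is_laurent_series_on c f S \<longleftrightarrow> (\<forall>z\<in>S. ((\<lambda>j. (z powi j) *\<^sub>C c j) has_sum f z) UNIV)"

text \<open>
  A chain is a function on \<^typ>\<open>nat\<close> of which only the values at indices \<open>n \<ge> 1\<close> matter;
  \<open>x n\<close> stands for \<open>x\<^bsub>-n\<^esub>\<close> in a singular and for \<open>x\<^bsub>n\<^esub>\<close> in a regular chain.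

  The growth condition is that the \<^emph>\<open>upper\<close> limit of the \<open>n\<close>-th roots is \<^emph>\<open>at most\<close> \<open>s\<close>
  (respectively \<open>1/r\<close>). Literally requiring the limit to exist and be equal to \<open>s\<close>
  is the same thing when \<open>s = 0\<close> (\<open>r = \<infinity>\<close>), see \<open>singular_chain_0_iff\<close> and
  \<open>regular_chain_infinity_iff\<close> below. For \<open>s > 0\<close> the literal condition does not define a subspace:
  for \<open>A(z) = z - s\<close> on the complex numbers, where the projection is the identity,
  every nonzero vector generates a chain with limit \<open>s\<close> but the zero vector does not
  (\<open>exact_limit_excludes_zero\<close>).
\<close>

definition singular_chain ::
    "('x::complex_normed_vector \<Rightarrow>\<^sub>L 'y::complex_normed_vector) \<Rightarrow> ('x \<Rightarrow>\<^sub>L 'y) \<Rightarrow> real \<Rightarrow> (nat \<Rightarrow> 'x) \<Rightarrow> bool"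
  where "singular_chain A0 A1 s x \<longleftrightarrow>
    (\<forall>n\<ge>1. A0 (x n) + A1 (x (Suc n)) = 0) \<and>
    limsup (\<lambda>n. ereal (root n (norm (x n)))) \<le> ereal s"

definition regular_chain ::
    "('x::complex_normed_vector \<Rightarrow>\<^sub>L 'y::complex_normed_vector) \<Rightarrow> ('x \<Rightarrow>\<^sub>L 'y) \<Rightarrow> ereal \<Rightarrow> (nat \<Rightarrow> 'x) \<Rightarrow> bool"
  where "regular_chain A0 A1 r x \<longleftrightarrow>
    (\<forall>n\<ge>1. A1 (x n) + A0 (x (Suc n)) = 0) \<and>
    limsup (\<lambda>n. ereal (root n (norm (x n)))) \<le> 1 / r"

definition singular_generating_subspace ::
    "('x::complex_normed_vector \<Rightarrow>\<^sub>L 'y::complex_normed_vector) \<Rightarrow> ('x \<Rightarrow>\<^sub>L 'y) \<Rightarrow> real \<Rightarrow> 'x set"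
  where "singular_generating_subspace A0 A1 s = {x 1 |x. singular_chain A0 A1 s x}"

definition regular_generating_subspace ::
    "('x::complex_normed_vector \<Rightarrow>\<^sub>L 'y::complex_normed_vector) \<Rightarrow> ('x \<Rightarrow>\<^sub>L 'y) \<Rightarrow> ereal \<Rightarrow> 'x set"
  where "regular_generating_subspace A0 A1 r = {x 1 |x. regular_chain A0 A1 r x}"

lemma limsup_le_0_iff_LIMSEQ:
  fixes f :: "nat \<Rightarrow> real"
  assumes nn: "\<And>n. 0 \<le> f n"
  shows "limsup (\<lambda>n. ereal (f n)) \<le> 0 \<longleftrightarrow> f \<longlonglongrightarrow> 0"
proof
  assume le: "limsup (\<lambda>n. ereal (f n)) \<le> 0"
  have "0 \<le> liminf (\<lambda>n. ereal (f n))"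
    by (rule Liminf_bounded) (simp add: nn)
  moreover have "liminf (\<lambda>n. ereal (f n)) \<le> limsup (\<lambda>n. ereal (f n))"
    by (rule Liminf_le_Limsup) simp
  ultimately have "(\<lambda>n. ereal (f n)) \<longlonglongrightarrow> 0"
    using le by (intro Liminf_eq_Limsup) (auto intro: order.antisym order.trans)
  then show "f \<longlonglongrightarrow> 0" by (simp add: zero_ereal_def)
next
  assume "f \<longlonglongrightarrow> 0"
  then have "(\<lambda>n. ereal (f n)) \<longlonglongrightarrow> 0" by (simp add: zero_ereal_def)
  then show "limsup (\<lambda>n. ereal (f n)) \<le> 0"
    by (simp add: lim_imp_Limsup)
qed

lemma singular_chain_0_iff:
  "singular_chain A0 A1 0 x \<longleftrightarrow>
    (\<forall>n\<ge>1. A0 (x n) + A1 (x (Suc n)) = 0) \<and> (\<lambda>n. root n (norm (x n))) \<longlonglongrightarrow> 0"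
  using limsup_le_0_iff_LIMSEQ[of "\<lambda>n. root n (norm (x n))", OF real_root_ge_zero[OF norm_ge_zero]]
  by (simp add: singular_chain_def zero_ereal_def)

lemma regular_chain_infinity_iff:
  "regular_chain A0 A1 \<infinity> x \<longleftrightarrow>
    (\<forall>n\<ge>1. A1 (x n) + A0 (x (Suc n)) = 0) \<and> (\<lambda>n. root n (norm (x n))) \<longlonglongrightarrow> 0"
  using limsup_le_0_iff_LIMSEQ[of "\<lambda>n. root n (norm (x n))", OF real_root_ge_zero[OF norm_ge_zero]]
  by (simp add: regular_chain_def)

lemma exact_limit_excludes_zero:
  fixes A0 A1 :: "'x::complex_normed_vector \<Rightarrow>\<^sub>L 'y::complex_normed_vector"
  assumes "s > 0" and inj: "\<And>v. A1 v = 0 \<Longrightarrow> v = 0"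
    and chain: "\<forall>n\<ge>1. A0 (x n) + A1 (x (Suc n)) = 0"
    and lim: "(\<lambda>n. root n (norm (x n))) \<longlonglongrightarrow> s"
  shows "x 1 \<noteq> 0"
proof
  assume x1: "x 1 = 0"
  have "x n = 0" if "n \<ge> 1" for n
    using that
  proof (induction n rule: dec_induct)
    case base
    show ?case by (rule x1)
  next
    case (step n)
    then have "A1 (x (Suc n)) = 0" using chain by (force simp: blinfun.zero_right)
    then show ?case by (rule inj)
  qed
  then have "\<forall>\<^sub>F n in sequentially. root n (norm (x n)) = 0"
    by (intro eventually_sequentiallyI[of 1]) simp
  then have "(\<lambda>n. root n (norm (x n))) \<longlonglongrightarrow> 0" by (rule tendsto_eventually)
  with lim have "s = 0" by (rule LIMSEQ_unique)
  with \<open>s > 0\<close> show False by simp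
qed

text \<open>
  The last conjunct says that the (complex-linear) addition map from the product \<open>V \<times> W\<close>
  onto the whole space is an isomorphism of topological vector spaces.
\<close>

definition topological_direct_sum :: "'a::complex_normed_vector set \<Rightarrow> 'a set \<Rightarrow> bool"
  where "topological_direct_sum V W \<longleftrightarrow>
    csubspace V \<and> csubspace W \<and> V \<inter> W = {0} \<and> {v + w |v w. v \<in> V \<and> w \<in> W} = UNIV \<and>
    (\<exists>g. homeomorphism (V \<times> W) UNIV (\<lambda>(v, w). v + w) g)"

end

theory Submission
  imports Defs "HOL-Library.Real_Mod"
begin

text \<open>
  Comparing Laurent coefficients in \<open>R(z)A(z) = I\<close> and \<open>A(z)R(z) = I\<close> gives
  \<open>R\<^sub>j A\<^sub>0 + R\<^bsub>j-1\<^esub> A\<^sub>1 = \<delta>\<^bsub>j0\<^esub> I\<close> and its mirror image. Along a chain these relations turn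
  \<open>R\<^sub>0 A\<^sub>0 x\<^bsub>-1\<^esub>\<close> into \<open>R\<^sub>n A\<^sub>0 x\<^bsub>-n-1\<^esub>\<close>. The coefficient \<open>R\<^sub>n\<close> is controlled by a radius \<open>\<sigma>\<close> of the
  annulus and the chain by a smaller radius \<open>\<rho>\<close>, so the value is \<open>O((\<rho>/\<sigma>)\<^sup>n)\<close> for every \<open>n\<close> and
  hence zero. Conversely \<open>R\<^bsub>-n\<^esub> A\<^sub>1 x\<close> is a singular chain starting at \<open>P x\<close>. The regular chains
  are symmetric, and the same decay gives \<open>R\<^bsub>-1\<^esub> A\<^sub>1 R\<^bsub>-1\<^esub> = R\<^bsub>-1\<^esub>\<close>.
\<close>

section \<open>Unconditionally convergent Laurent series\<close>

lemma has_sum_approximation: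
  fixes f :: "'i \<Rightarrow> 'a::real_normed_vector"
  assumes "(f has_sum l) UNIV" "e > 0"
  obtains F where "finite F" "\<And>G. finite G \<Longrightarrow> F \<subseteq> G \<Longrightarrow> norm (sum f G - l) < e"
proof -
  have "\<forall>\<^sub>F F in finite_subsets_at_top UNIV. dist (sum f F) l < e"
    using assms unfolding has_sum_def by (rule tendstoD)
  then obtain F where F: "finite F" "\<forall>G. finite G \<and> F \<subseteq> G \<and> G \<subseteq> UNIV \<longrightarrow> dist (sum f G) l < e"
    unfolding eventually_finite_subsets_at_top by blast
  show thesis by (rule that[OF F(1)]) (use F(2) in \<open>simp add: dist_norm\<close>)
qed

text \<open>Cauchy criterion for unconditional summation: \<open>F\<close> and
  \<open>F \<union> G\<close> both give partial sums within \<open>e\<close> of the limit. Absolute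
  convergence is not among the hypotheses, so the tail is controlled as a sum and not term by
  term.\<close>

lemma has_sum_tail:
  fixes f :: "'i \<Rightarrow> 'a::real_normed_vector"
  assumes "(f has_sum l) UNIV" "e > 0"
  obtains F where "finite F" "\<And>G. finite G \<Longrightarrow> F \<inter> G = {} \<Longrightarrow> norm (sum f G) < 2 * e"
proof -
  obtain F where F: "finite F" "\<And>G. finite G \<Longrightarrow> F \<subseteq> G \<Longrightarrow> norm (sum f G - l) < e"
    using has_sum_approximation[OF assms] by blast
  have "norm (sum f G) < 2 * e" if G: "finite G" "F \<inter> G = {}" for G
  proof -
    have "sum f G = (sum f (F \<union> G) - l) - (sum f F - l)"
      using F(1) G by (simp add: sum.union_disjoint)
    then have "norm (sum f G) \<le> norm (sum f (F \<union> G) - l) + norm (sum f F - l)"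
      by (metis norm_triangle_ineq4)
    also have "\<dots> < e + e" using F(1) G(1) by (intro add_strict_mono F(2)) auto
    finally show ?thesis by simp
  qed
  with F(1) that show thesis by blast
qed

text \<open>A term outside \<open>F\<close> is itself a one-element tail, and \<open>F\<close> is
  finite. Applied at a single point of the annulus, this plays the part of a Cauchy
  estimate.\<close>

lemma has_sum_bounded_terms:
  fixes f :: "'i \<Rightarrow> 'a::real_normed_vector"
  assumes "(f has_sum l) UNIV"
  obtains C where "C > 0" "\<And>i. norm (f i) \<le> C"
proof -
  obtain F where F: "finite F" "\<And>G. finite G \<Longrightarrow> F \<inter> G = {} \<Longrightarrow> norm (sum f G) < 2 * 1"
    using has_sum_tail[OF assms zero_less_one] by blast
  define C where "C = 2 + (\<Sum>i\<in>F. norm (f i))"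
  have pos: "0 \<le> (\<Sum>i\<in>F. norm (f i))" by (simp add: sum_nonneg)
  have "norm (f i) \<le> C" for i
  proof (cases "i \<in> F")
    case True
    then show ?thesis
      using member_le_sum[of i F "\<lambda>i. norm (f i)"] F(1) by (simp add: C_def)
  next
    case False
    then show ?thesis using F(2)[of "{i}"] pos by (simp add: C_def)
  qed
  moreover have "C > 0" using pos by (simp add: C_def)
  ultimately show thesis using that by blast
qed

lemma has_sum_sum_finite:
  fixes f :: "'k \<Rightarrow> 'i \<Rightarrow> 'a::topological_comm_monoid_add"
  assumes "finite K" "\<And>k. k \<in> K \<Longrightarrow> (f k has_sum l k) A"
  shows "((\<lambda>i. \<Sum>k\<in>K. f k i) has_sum (\<Sum>k\<in>K. l k)) A"
  using assms by (induction K rule: finite_induct) (auto intro!: has_sum_add)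

lemma has_sum_minus:
  fixes f g :: "'i \<Rightarrow> 'a::real_normed_vector"
  assumes "(f has_sum l) A" "(g has_sum m) A"
  shows "((\<lambda>i. f i - g i) has_sum (l - m)) A"
proof -
  have "sum (\<lambda>i. f i - g i) = (\<lambda>F. sum f F - sum g F)" by (simp add: fun_eq_iff sum_subtractf)
  then show ?thesis using tendsto_diff[OF assms[unfolded has_sum_def]] by (simp add: has_sum_def)
qed

text \<open>The sum is geometric in \<open>w = cis (2 * pi * d / N)\<close>. Since
  \<open>w ^ N = 1\<close>, it vanishes unless \<open>w = 1\<close>.\<close>

lemma sum_roots_of_unity_powi:
  fixes N :: nat and d :: int
  assumes "N > 0"
  shows "(\<Sum>k<N. cis (2 * pi * real k / real N) powi d) = (if int N dvd d then of_nat N else 0)"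
proof -
  define w where "w = cis (2 * pi * of_int d / real N)"
  have powi_eq: "cis (2 * pi * real k / real N) powi d = w ^ k" for k
    by (simp only: w_def cis_power_int Complex.DeMoivre times_divide_eq_right)
      (simp add: mult_ac)
  have wN: "w ^ N = 1"
    using assms cis_multiple_2pi[of "of_int d"] by (simp add: w_def Complex.DeMoivre mult_ac)
  have w1: "w = 1 \<longleftrightarrow> int N dvd d"
  proof
    assume "w = 1"
    then obtain n where "2 * pi * of_int d / real N = of_int n * (2 * pi)"
      unfolding w_def cis_eq_1_iff by blast
    then have "real_of_int d = of_int (n * int N)" using assms by (simp add: field_simps)
    then have "d = n * int N" by (simp only: of_int_eq_iff)
    then show "int N dvd d" by simp
  next
    assume "int N dvd d"
    then obtain n where "d = int N * n" by blast
    then have "2 * pi * of_int d / real N = of_int n * (2 * pi)" using assms by simp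
    then show "w = 1" unfolding w_def cis_eq_1_iff by blast
  qed
  show ?thesis
  proof (cases "w = 1")
    case True
    then show ?thesis using w1 by (simp add: powi_eq)
  next
    case False
    then show ?thesis using wN w1 geometric_sum[of w N] by (simp add: powi_eq)
  qed
qed

text \<open>
  Averaging over the \<open>N\<close>-th roots of unity keeps only the coefficients with index congruent to \<open>m\<close>
  modulo \<open>N\<close>; for large \<open>N\<close> those other than \<open>m\<close> lie in a small tail.
\<close>

lemma laurent_coeff_eq_0:
  fixes c :: "int \<Rightarrow> 'a::complex_normed_vector"
  assumes \<rho>: "\<rho> > 0"
    and sums: "\<And>z. cmod z = \<rho> \<Longrightarrow> ((\<lambda>j. (z powi j) *\<^sub>C c j) has_sum 0) UNIV"
  shows "c m = 0"
proof (rule ccontr)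
  assume cm: "c m \<noteq> 0"
  define b where "b j = (complex_of_real \<rho> powi j) *\<^sub>C c j" for j
  \<comment> \<open>The final estimate spends \<open>e\<close> on the averaged sum and
    \<open>2 * e\<close> on the tail, so a third of the norm yields the contradiction.\<close>
  define e where "e = norm (b m) / 3"
  have e: "e > 0"
    using cm \<rho> by (simp add: e_def b_def norm_scaleC norm_power_int)
  have "(b has_sum 0) UNIV" unfolding b_def using \<rho> by (intro sums) simp
  then obtain F where F: "finite F" "\<And>G. finite G \<Longrightarrow> F \<inter> G = {} \<Longrightarrow> norm (sum b G) < 2 * e"
    using has_sum_tail[OF _ e] by blast
  \<comment> \<open>\<open>N\<close> exceeds \<open>\<bar>j - m\<bar>\<close> for every
    \<open>j\<close> in \<open>F\<close>, so \<open>m\<close> is the only index that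
    \<open>F\<close> can share with its residue class modulo \<open>N\<close>.\<close>
  define N where "N = nat (1 + (\<Sum>j\<in>F. \<bar>j - m\<bar>))"
  have N: "int N = 1 + (\<Sum>j\<in>F. \<bar>j - m\<bar>)" by (simp add: N_def sum_nonneg)
  moreover have "0 \<le> (\<Sum>j\<in>F. \<bar>j - m\<bar>)" by (simp add: sum_nonneg)
  ultimately have "N > 0" by linarith
  have far: "j = m" if "j \<in> F" "int N dvd j - m" for j
  proof -
    have "\<bar>j - m\<bar> < int N"
      using member_le_sum[of j F "\<lambda>j. \<bar>j - m\<bar>"] F(1) that(1) N by simp
    then show ?thesis using that(2) zdvd_not_zless[of "\<bar>j - m\<bar>" "int N"] by fastforce
  qed
  define u where "u k = cis (2 * pi * real k / real N)" for k
  \<comment> \<open>The twist by \<open>u k powi (- m)\<close> moves the residue class that survives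
    the averaging from 0 to that of \<open>m\<close>.\<close>
  define g where "g j = (\<Sum>k<N. (u k powi (- m)) *\<^sub>C ((complex_of_real \<rho> * u k) powi j) *\<^sub>C c j)" for j
  have "(g has_sum (\<Sum>k<N. (u k powi (- m)) *\<^sub>C 0)) UNIV"
    unfolding g_def
  proof (rule has_sum_sum_finite)
    fix k
    have "cmod (complex_of_real \<rho> * u k) = \<rho>" using \<rho> by (simp add: norm_mult u_def)
    from has_sum_bounded_linear[OF bounded_linear_scaleC sums[OF this], of "u k powi (- m)"]
    show "((\<lambda>j. (u k powi (- m)) *\<^sub>C ((complex_of_real \<rho> * u k) powi j) *\<^sub>C c j) has_sum
        (u k powi (- m)) *\<^sub>C 0) UNIV" .
  qed simp
  then have g0: "(g has_sum 0) UNIV" by simp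
  have g: "g j = (if int N dvd j - m then of_nat N *\<^sub>C b j else 0)" for j
  proof -
    have "(u k powi (- m)) *\<^sub>C ((complex_of_real \<rho> * u k) powi j) *\<^sub>C c j = (u k powi (j - m)) *\<^sub>C b j" for k
      by (simp add: scaleC_scaleC b_def power_int_mult_distrib power_int_diff power_int_minus u_def field_simps)
    then have "g j = (\<Sum>k<N. u k powi (j - m)) *\<^sub>C b j"
      by (simp add: g_def complex_vector.scale_sum_left)
    then show ?thesis
      using sum_roots_of_unity_powi[OF \<open>N > 0\<close>, of "j - m"] by (simp add: u_def)
  qed
  \<comment> \<open>The sum over the roots is not divided by \<open>N\<close>, so the tolerance is
    scaled by \<open>N\<close> instead.\<close>
  have "real N * e > 0" using \<open>N > 0\<close> e by simp
  then obtain F' where F': "finite F'"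
      "\<And>G. finite G \<Longrightarrow> F' \<subseteq> G \<Longrightarrow> norm (sum g G - 0) < real N * e"
    using has_sum_approximation[OF g0] by blast
  \<comment> \<open>Inserting \<open>m\<close> guarantees that \<open>b m\<close> is present; by
    \<open>far\<close>, the rest of \<open>H\<close> avoids \<open>F\<close> and is a small
    tail.\<close>
  define H where "H = {j \<in> insert m F'. int N dvd j - m}"
  have "sum g (insert m F') = (\<Sum>j\<in>insert m F'. if int N dvd j - m then of_nat N *\<^sub>C b j else 0)"
    by (rule sum.cong) (simp_all add: g)
  also have "\<dots> = (\<Sum>j\<in>H. of_nat N *\<^sub>C b j)"
    unfolding H_def using F'(1) by (intro sum.inter_filter[symmetric]) simp
  also have "\<dots> = of_nat N *\<^sub>C sum b H" by (simp add: complex_vector.scale_sum_right)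
  finally have "norm (sum b H) < e"
    using F'(2)[of "insert m F'"] F'(1) \<open>N > 0\<close> by (auto simp: norm_scaleC)
  moreover have "norm (sum b (H - {m})) < 2 * e"
    using far F'(1) by (intro F(2)) (auto simp: H_def)
  moreover have "sum b H = b m + sum b (H - {m})"
    using F'(1) by (intro sum.remove) (auto simp: H_def)
  ultimately have "norm (b m) < 3 * e"
    using norm_triangle_ineq4[of "sum b H" "sum b (H - {m})"] by simp
  then show False by (simp add: e_def)
qed

section \<open>Growth of sequences\<close>

text \<open>The constant disappears in the limit because \<open>root n C\<close> tends to 1 for
  \<open>C > 0\<close>.\<close>

lemma limsup_root_le:
  fixes x :: "nat \<Rightarrow> 'a::real_normed_vector"
  assumes "C > 0" "\<rho> > 0" and bound: "\<And>n. n \<ge> 1 \<Longrightarrow> norm (x n) \<le> C * \<rho> ^ n"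
  shows "limsup (\<lambda>n. ereal (root n (norm (x n)))) \<le> ereal \<rho>"
proof -
  have "(\<lambda>n. root n C * \<rho>) \<longlonglongrightarrow> 1 * \<rho>"
    using \<open>C > 0\<close> by (intro tendsto_intros LIMSEQ_root_const)
  then have lim: "limsup (\<lambda>n. ereal (root n C * \<rho>)) = ereal \<rho>"
    by (intro lim_imp_Limsup tendsto_ereal) simp_all
  have "root n (norm (x n)) \<le> root n C * \<rho>" if "n \<ge> 1" for n
  proof -
    have "root n (norm (x n)) \<le> root n (C * \<rho> ^ n)"
      using bound[OF that] that by (intro real_root_le_mono) simp_all
    also have "\<dots> = root n C * \<rho>"
      using that \<open>\<rho> > 0\<close> by (simp add: real_root_mult real_root_power_cancel)
    finally show ?thesis .
  qed
  then have "\<forall>\<^sub>F n in sequentially. ereal (root n (norm (x n))) \<le> ereal (root n C * \<rho>)"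
    by (intro eventually_sequentiallyI[of 1]) simp
  from Limsup_mono[OF this] show ?thesis by (simp add: lim)
qed

lemma limsup_root_lessD:
  fixes x :: "nat \<Rightarrow> 'a::real_normed_vector"
  assumes "limsup (\<lambda>n. ereal (root n (norm (x n)))) < ereal \<tau>"
  shows "\<forall>\<^sub>F n in sequentially. norm (x n) \<le> \<tau> ^ n"
proof -
  have "\<forall>\<^sub>F n in sequentially. root n (norm (x n)) < \<tau>"
    using Limsup_lessD[OF assms] by simp
  then show ?thesis
    using eventually_ge_at_top[of 1]
  proof eventually_elim
    case (elim n)
    then have "norm (x n) = root n (norm (x n)) ^ n" by simp
    also have "\<dots> \<le> \<tau> ^ n" using elim by (intro power_mono) simp_all
    finally show ?case .
  qed
qed

lemma eq_0_if_norm_le_geometric: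
  fixes v :: "'a::real_normed_vector"
  assumes "0 \<le> q" "q < 1" and "\<forall>\<^sub>F n in sequentially. norm v \<le> K * q ^ n"
  shows "v = 0"
proof -
  have "(\<lambda>n. K * q ^ n) \<longlonglongrightarrow> K * 0"
    using assms(1,2) by (intro tendsto_intros LIMSEQ_power_zero) simp
  from tendsto_lowerbound[OF this assms(3)] show ?thesis by simp
qed

section \<open>Complex-linear projections\<close>

lemma clinear_blinfun_iff:
  fixes T :: "'a::complex_normed_vector \<Rightarrow>\<^sub>L 'b::complex_normed_vector"
  shows "clinear (blinfun_apply T) \<longleftrightarrow> (\<forall>c x. T (c *\<^sub>C x) = c *\<^sub>C T x)"
  by (simp add: Vector_Spaces.linear_iff blinfun.add_right complex_vector.vector_space_axioms)

lemma csubspace_range: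
  fixes T :: "'a::complex_normed_vector \<Rightarrow>\<^sub>L 'b::complex_normed_vector"
  assumes "clinear T"
  shows "csubspace (range T)"
proof -
  have "c *\<^sub>C T x \<in> range T" for c x
    using assms[unfolded clinear_blinfun_iff] by (metis rangeI)
  moreover have "T x + T y \<in> range T" for x y by (metis blinfun.add_right rangeI)
  moreover have "0 \<in> range T" by (metis blinfun.zero_right rangeI)
  ultimately show ?thesis by (auto simp: complex_vector.subspace_def)
qed

text \<open>The inverse of addition is \<open>x \<mapsto> (T x, x - T x)\<close>, which is
  continuous because \<open>T\<close> is bounded.\<close>

lemma topological_direct_sum_projection:
  fixes T :: "'a::complex_normed_vector \<Rightarrow>\<^sub>L 'a"
  assumes lin: "clinear T" and idem: "T o\<^sub>L T = T"
  shows "topological_direct_sum (range T) (range (id_blinfun - T))"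
proof -
  have TT: "T (T x) = T x" for x
    using arg_cong[OF idem, of "\<lambda>S. blinfun_apply S x"] by simp
  have c: "(id_blinfun - T) x = x - T x" for x by (simp add: blinfun.diff_left)
  have lin': "clinear (id_blinfun - T)"
    using lin unfolding clinear_blinfun_iff
    by (simp add: c complex_vector.scale_right_diff_distrib)
  have rT: "T v = v" if "v \<in> range T" for v using that TT by auto
  have rc: "T v = 0" if "v \<in> range (id_blinfun - T)" for v
    using that by (auto simp: c TT blinfun.diff_right)
  have dec: "T x + (id_blinfun - T) x = x" for x by (simp add: c)
  have "homeomorphism (range T \<times> range (id_blinfun - T)) UNIV (\<lambda>(v, w). v + w)
      (\<lambda>x. (T x, (id_blinfun - T) x))"
  proof (rule homeomorphismI)
    show "continuous_on (range T \<times> range (id_blinfun - T)) (\<lambda>(v, w). v + w)"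
      by (auto simp: case_prod_beta intro!: continuous_intros)
    show "continuous_on UNIV (\<lambda>x. (T x, (id_blinfun - T) x))"
      by (intro continuous_intros)
    show "(\<lambda>x. (T x, (id_blinfun - T) x)) ` UNIV \<subseteq> range T \<times> range (id_blinfun - T)" by blast
    fix p assume "p \<in> range T \<times> range (id_blinfun - T)"
    then obtain v w where p: "p = (v, w)" "T v = v" "T w = 0" using rT rc by blast
    then show "(T (case p of (v, w) \<Rightarrow> v + w), (id_blinfun - T) (case p of (v, w) \<Rightarrow> v + w)) = p"
      by (simp add: c blinfun.add_right)
  next
    show "(case (T y, (id_blinfun - T) y) of (v, w) \<Rightarrow> v + w) = y" for y
      using dec by simp
  qed simp
  moreover have "range T \<inter> range (id_blinfun - T) = {0}"
  proof
    show "range T \<inter> range (id_blinfun - T) \<subseteq> {0}"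
    proof
      fix v assume "v \<in> range T \<inter> range (id_blinfun - T)"
      then have "T v = v" "T v = 0" using rT rc by blast+
      then show "v \<in> {0}" by simp
    qed
    show "{0} \<subseteq> range T \<inter> range (id_blinfun - T)"
      using complex_vector.subspace_0[OF csubspace_range[OF lin]]
        complex_vector.subspace_0[OF csubspace_range[OF lin']] by blast
  qed
  moreover have "{v + w |v w. v \<in> range T \<and> w \<in> range (id_blinfun - T)} = UNIV"
  proof (intro equalityI subsetI UNIV_I)
    fix x
    have "x = T x + (id_blinfun - T) x" by (rule dec[symmetric])
    then show "x \<in> {v + w |v w. v \<in> range T \<and> w \<in> range (id_blinfun - T)}" by blast
  qed
  ultimately show ?thesis
    unfolding topological_direct_sum_def
    using csubspace_range[OF lin] csubspace_range[OF lin'] by blast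
qed

section \<open>Resolvent of a linear pencil on an annulus\<close>

locale pencil_resolvent =
  fixes A0 A1 :: "'x::complex_normed_vector \<Rightarrow>\<^sub>L 'y::complex_normed_vector"
    and R :: "complex \<Rightarrow> 'y \<Rightarrow>\<^sub>L 'x"
    and Rc :: "int \<Rightarrow> 'y \<Rightarrow>\<^sub>L 'x"
    and s :: real and r :: ereal
  assumes lin0: "clinear A0" and lin1: "clinear A1"
    and s_nonneg: "0 \<le> s" and s_less_r: "ereal s < r"
    and resolvent: "is_resolvent_on A0 A1 R (annulus s r)"
    and laurent: "is_laurent_series_on Rc R (annulus s r)"
begin

text \<open>The lower bound \<open>a\<close> allows a second radius to be chosen beyond a first one,
  which is what makes the quotients \<open>\<rho> / \<sigma>\<close> below smaller than 1.\<close>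

lemma radius_between:
  assumes "ereal a < r"
  obtains \<rho> where "s < \<rho>" "a < \<rho>" "ereal \<rho> < r"
proof -
  have "ereal (max s a) < r" using assms s_less_r by (simp add: max_def)
  from ereal_dense2[OF this] that show thesis by auto
qed

section \<open>Coefficient equations of the pencil\<close>

lemma has_sum_resolvent:
  assumes "z \<in> annulus s r"
  shows "((\<lambda>j. (z powi j) *\<^sub>C Rc j y) has_sum R z y) UNIV"
proof -
  have "((\<lambda>j. (z powi j) *\<^sub>C Rc j) has_sum R z) UNIV"
    using laurent assms by (simp add: is_laurent_series_on_def)
  from has_sum_bounded_linear[OF blinfun.bounded_linear_left this, of y]
  show ?thesis by (simp add: scaleC_blinfun.rep_eq)
qed

lemma coeff_eq_0:
  fixes c :: "int \<Rightarrow> 'a::complex_normed_vector"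
  assumes "\<And>z. z \<in> annulus s r \<Longrightarrow> z \<noteq> 0 \<Longrightarrow> ((\<lambda>j. (z powi j) *\<^sub>C c j) has_sum 0) UNIV"
  shows "c m = 0"
proof -
  obtain \<rho> where "s < \<rho>" "ereal \<rho> < r" using radius_between[OF s_less_r] by blast
  then show ?thesis
    using s_nonneg by (intro laurent_coeff_eq_0[of \<rho>] assms) (auto simp: annulus_def)
qed

lemma scaleC0: "A0 (c *\<^sub>C x) = c *\<^sub>C A0 x" and scaleC1: "A1 (c *\<^sub>C x) = c *\<^sub>C A1 x"
  using lin0 lin1 by (simp_all add: clinear_blinfun_iff)

lemma scaleC_R: "z \<in> annulus s r \<Longrightarrow> R z (c *\<^sub>C y) = c *\<^sub>C R z y"
  using resolvent by (simp add: is_resolvent_on_def clinear_blinfun_iff)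

text \<open>The type of \<open>Rc j\<close> provides only real linearity. Complex linearity passes
  from \<open>R z\<close> to the coefficients by uniqueness of the Laurent expansion.\<close>

lemma scaleC_Rc: "Rc j (c *\<^sub>C y) = c *\<^sub>C Rc j y"
proof -
  have "Rc j (c *\<^sub>C y) - c *\<^sub>C Rc j y = 0"
  proof (rule coeff_eq_0)
    fix z assume z: "z \<in> annulus s r"
    have "((\<lambda>j. (z powi j) *\<^sub>C Rc j (c *\<^sub>C y) - c *\<^sub>C (z powi j) *\<^sub>C Rc j y) has_sum
        (R z (c *\<^sub>C y) - c *\<^sub>C R z y)) UNIV"
      by (intro has_sum_minus has_sum_bounded_linear[OF bounded_linear_scaleC] has_sum_resolvent[OF z])
    then show "((\<lambda>j. (z powi j) *\<^sub>C (Rc j (c *\<^sub>C y) - c *\<^sub>C Rc j y)) has_sum 0) UNIV"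
      by (simp add: scaleC_R[OF z] scaleC_scaleC complex_vector.scale_right_diff_distrib mult.commute)
  qed
  then show ?thesis by simp
qed

text \<open>Multiplication by \<open>z\<close> shifts the coefficients by one. This is how the term
  \<open>z *\<^sub>C A1\<close> of the pencil brings in the index \<open>j - 1\<close>.\<close>

lemma has_sum_shift:
  fixes c :: "int \<Rightarrow> 'a::complex_normed_vector"
  assumes "z \<noteq> 0" and "((\<lambda>j. (z powi j) *\<^sub>C c j) has_sum l) UNIV"
  shows "((\<lambda>j. (z powi j) *\<^sub>C c (j - 1)) has_sum z *\<^sub>C l) UNIV"
proof -
  have "((\<lambda>j. (z powi (j - 1)) *\<^sub>C c (j - 1)) has_sum l) UNIV"
    using assms(2) has_sum_reindex_bij_betw[of "\<lambda>j::int. j - 1" UNIV UNIV "\<lambda>j. (z powi j) *\<^sub>C c j" l]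
    by (simp add: bij_betw_byWitness[where f' = "\<lambda>j. j + 1"])
  from has_sum_bounded_linear[OF bounded_linear_scaleC this, of z]
  show ?thesis using assms(1) by (simp add: scaleC_scaleC power_int_diff)
qed

lemma has_sum_delta:
  fixes x :: "'a::complex_normed_vector"
  shows "((\<lambda>j. (z powi j) *\<^sub>C (if j = 0 then x else 0)) has_sum x) UNIV"
  by (rule has_sum_finite_neutralI[of "{0}"]) (simp_all add: scaleC_one)

lemma left_equation: "Rc j (A0 x) + Rc (j - 1) (A1 x) = (if j = 0 then x else 0)"
proof -
  have "Rc j (A0 x) + Rc (j - 1) (A1 x) - (if j = 0 then x else 0) = 0"
  proof (rule coeff_eq_0[where m = j and c = "\<lambda>j. Rc j (A0 x) + Rc (j - 1) (A1 x) - (if j = 0 then x else 0)"])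
    fix z assume z: "z \<in> annulus s r" and "z \<noteq> 0"
    have "((\<lambda>j. (z powi j) *\<^sub>C Rc j (A0 x) + (z powi j) *\<^sub>C Rc (j - 1) (A1 x)
          - (z powi j) *\<^sub>C (if j = 0 then x else 0)) has_sum
        (R z (A0 x) + z *\<^sub>C R z (A1 x) - x)) UNIV"
      by (intro has_sum_minus has_sum_add has_sum_resolvent[OF z] has_sum_delta
          has_sum_shift[OF \<open>z \<noteq> 0\<close>, of "\<lambda>j. Rc j (A1 x)"])
    moreover have "R z (A0 x) + z *\<^sub>C R z (A1 x) = (R z o\<^sub>L pencil A0 A1 z) x"
      using scaleC_R[OF z] by (simp add: pencil_def blinfun.add_left blinfun.add_right scaleC_blinfun.rep_eq)
    moreover have "R z o\<^sub>L pencil A0 A1 z = id_blinfun"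
      using resolvent z by (simp add: is_resolvent_on_def)
    ultimately show "((\<lambda>j. (z powi j) *\<^sub>C (Rc j (A0 x) + Rc (j - 1) (A1 x)
        - (if j = 0 then x else 0))) has_sum 0) UNIV"
      by (simp add: complex_vector.scale_right_diff_distrib scaleC_add_right)
  qed
  then show ?thesis by simp
qed

lemma right_equation: "A0 (Rc j y) + A1 (Rc (j - 1) y) = (if j = 0 then y else 0)"
proof -
  have "A0 (Rc j y) + A1 (Rc (j - 1) y) - (if j = 0 then y else 0) = 0"
  proof (rule coeff_eq_0[where m = j and c = "\<lambda>j. A0 (Rc j y) + A1 (Rc (j - 1) y) - (if j = 0 then y else 0)"])
    fix z assume z: "z \<in> annulus s r" and "z \<noteq> 0"
    have "((\<lambda>j. A0 ((z powi j) *\<^sub>C Rc j y) + A1 ((z powi j) *\<^sub>C Rc (j - 1) y)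
          - (z powi j) *\<^sub>C (if j = 0 then y else 0)) has_sum
        (A0 (R z y) + A1 (z *\<^sub>C R z y) - y)) UNIV"
      by (intro has_sum_minus has_sum_add has_sum_bounded_linear[OF blinfun.bounded_linear_right]
          has_sum_resolvent[OF z] has_sum_delta has_sum_shift[OF \<open>z \<noteq> 0\<close>, of "\<lambda>j. Rc j y"])
    moreover have "A0 (R z y) + A1 (z *\<^sub>C R z y) = (pencil A0 A1 z o\<^sub>L R z) y"
      by (simp add: pencil_def blinfun.add_left scaleC_blinfun.rep_eq scaleC1)
    moreover have "pencil A0 A1 z o\<^sub>L R z = id_blinfun"
      using resolvent z by (simp add: is_resolvent_on_def)
    ultimately show "((\<lambda>j. (z powi j) *\<^sub>C (A0 (Rc j y) + A1 (Rc (j - 1) y)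
        - (if j = 0 then y else 0))) has_sum 0) UNIV"
      by (simp add: scaleC0 scaleC1 complex_vector.scale_right_diff_distrib scaleC_add_right)
  qed
  then show ?thesis by simp
qed

section \<open>Coefficient bounds on circles and passage to the boundary radii\<close>

lemma coeff_bound:
  assumes "s < \<rho>" "ereal \<rho> < r"
  obtains C where "C > 0" "\<And>j. norm (Rc j) \<le> C * \<rho> powi (- j)"
proof -
  have \<rho>: "\<rho> > 0" using assms(1) s_nonneg by simp
  then have "complex_of_real \<rho> \<in> annulus s r" using assms by (simp add: annulus_def)
  then have "((\<lambda>j. (complex_of_real \<rho> powi j) *\<^sub>C Rc j) has_sum R \<rho>) UNIV"
    using laurent by (simp add: is_laurent_series_on_def)
  then obtain C where C: "C > 0" "\<And>j. norm ((complex_of_real \<rho> powi j) *\<^sub>C Rc j) \<le> C"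
    using has_sum_bounded_terms by blast
  have "norm (Rc j) \<le> C * \<rho> powi (- j)" for j
    using C(2)[of j] \<rho> by (simp add: norm_scaleC norm_power_int power_int_minus field_simps)
  with C(1) that show thesis by blast
qed

lemma coeff_bound_nonneg:
  assumes "s < \<rho>" "ereal \<rho> < r"
  obtains C where "C > 0" "\<And>n. norm (Rc (int n)) \<le> C * (1 / \<rho>) ^ n"
proof -
  obtain C where C: "C > 0" "\<And>j. norm (Rc j) \<le> C * \<rho> powi (- j)"
    using coeff_bound[OF assms] by blast
  have "norm (Rc (int n)) \<le> C * (1 / \<rho>) ^ n" for n
    using C(2)[of "int n"] by (simp add: power_int_minus power_divide divide_inverse power_inverse)
  with C(1) that show thesis by blast
qed

lemma coeff_bound_nonpos:
  assumes "s < \<rho>" "ereal \<rho> < r"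
  obtains C where "C > 0" "\<And>n. norm (Rc (- int n)) \<le> C * \<rho> ^ n"
proof -
  obtain C where C: "C > 0" "\<And>j. norm (Rc j) \<le> C * \<rho> powi (- j)"
    using coeff_bound[OF assms] by blast
  have "norm (Rc (- int n)) \<le> C * \<rho> ^ n" for n
    using C(2)[of "- int n"] by simp
  with C(1) that show thesis by blast
qed

text \<open>Coefficient bounds exist only for radii strictly inside the annulus, so the growth rate
  \<open>s\<close> is reached as a limit. A radius below \<open>min L r\<close> would lie in the
  annulus and contradict the bound.\<close>

lemma limsup_le_s:
  assumes "\<And>\<rho>. s < \<rho> \<Longrightarrow> ereal \<rho> < r \<Longrightarrow> L \<le> ereal \<rho>"
  shows "L \<le> ereal s"
proof (rule ccontr)
  assume "\<not> L \<le> ereal s"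
  then have "ereal s < min L r" using s_less_r by simp
  from ereal_dense2[OF this] obtain \<rho> where "ereal s < ereal \<rho>" "ereal \<rho> < min L r" by blast
  with assms[of \<rho>] show False by auto
qed

lemma limsup_le_inverse_r:
  assumes "\<And>\<rho>. s < \<rho> \<Longrightarrow> ereal \<rho> < r \<Longrightarrow> L \<le> ereal (1 / \<rho>)"
  shows "L \<le> 1 / r"
proof (rule ccontr)
  assume "\<not> L \<le> 1 / r"
  then have L: "1 / r < L" by simp
  have r: "r > 0" using s_less_r s_nonneg by (cases r) auto
  \<comment> \<open>A first radius shows that \<open>L\<close> is finite. Only then is
    \<open>1 / l\<close> available as a lower bound for the second radius, which gives the
    contradiction.\<close>
  obtain \<rho>0 where "s < \<rho>0" "ereal \<rho>0 < r" using radius_between[OF s_less_r] by blast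
  then have "L \<le> ereal (1 / \<rho>0)" by (rule assms)
  moreover have "0 \<le> 1 / r" using r by (cases r) auto
  then have "L > 0" using L by (rule order.strict_trans1)
  ultimately obtain l where l: "L = ereal l" "l > 0" by (cases L) auto
  have "ereal (1 / l) < r" using L r l by (cases r) (auto simp: field_simps one_ereal_def)
  from radius_between[OF this] obtain \<rho> where \<rho>: "s < \<rho>" "1 / l < \<rho>" "ereal \<rho> < r" by blast
  have "1 / \<rho> < l" using \<rho>(1,2) l(2) s_nonneg by (simp add: field_simps)
  then show False using assms[OF \<rho>(1,3)] l(1) by simp
qed

section \<open>Index shifts and idempotence\<close>

lemma Rc_A0_shift: "j \<noteq> 0 \<Longrightarrow> Rc j (A0 x) = - Rc (j - 1) (A1 x)"
  using left_equation[of j x] by (simp add: eq_neg_iff_add_eq_0)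

lemma A0_Rc_shift: "j \<noteq> 0 \<Longrightarrow> A0 (Rc j y) = - A1 (Rc (j - 1) y)"
  using right_equation[of j y] by (simp add: eq_neg_iff_add_eq_0)

lemma Rc_0_A0: "Rc 0 (A0 x) = x - Rc (- 1) (A1 x)"
  using left_equation[of 0 x] by (simp add: algebra_simps)

lemma A0_Rc_0: "A0 (Rc 0 y) = y - A1 (Rc (- 1) y)"
  using right_equation[of 0 y] by (simp add: algebra_simps)

text \<open>
  By the coefficient equations this equals \<open>R\<^sub>n A\<^sub>1 R\<^bsub>-2-n\<^esub> y\<close> for every \<open>n\<close>, which tends to zero when the
  two coefficients are estimated on different radii.
\<close>

lemma cross_term_eq_0: "Rc 0 (A1 (Rc (- 2) y)) = 0"
proof -
  have shift: "Rc (int n) (A1 (Rc (- 2 - int n) y)) = Rc 0 (A1 (Rc (- 2) y))" for n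
  \<comment> \<open>Each step uses one right and one left coefficient equation, so the signs cancel.
    The indices \<open>- 2 - n\<close> and \<open>n + 1\<close> are never 0, so no identity term
    enters.\<close>
  proof (induction n)
    case (Suc n)
    have "Rc (int (Suc n)) (A1 (Rc (- 2 - int (Suc n)) y))
        = Rc (int (Suc n)) (- A0 (Rc (- 2 - int n) y))"
      using A0_Rc_shift[of "- 2 - int n" y] by (simp add: algebra_simps)
    also have "\<dots> = Rc (int n) (A1 (Rc (- 2 - int n) y))"
      using Rc_A0_shift[of "int (Suc n)"] by (simp add: blinfun.minus_right)
    finally show ?case using Suc by simp
  qed simp
  obtain \<rho> where \<rho>: "s < \<rho>" "ereal \<rho> < r" using radius_between[OF s_less_r] by blast
  obtain \<sigma> where \<sigma>: "s < \<sigma>" "\<rho> < \<sigma>" "ereal \<sigma> < r" using radius_between[OF \<rho>(2)] by blast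
  obtain C where C: "C > 0" "\<And>n. norm (Rc (- int n)) \<le> C * \<rho> ^ n" using coeff_bound_nonpos[OF \<rho>] by blast
  obtain D where D: "D > 0" "\<And>n. norm (Rc (int n)) \<le> D * (1 / \<sigma>) ^ n"
    using coeff_bound_nonneg[OF \<sigma>(1,3)] by blast
  have pos: "\<rho> > 0" "\<sigma> > 0" using \<rho>(1) \<sigma>(1) s_nonneg by simp_all
  have "norm (Rc 0 (A1 (Rc (- 2) y))) \<le> (D * norm A1 * C * \<rho>\<^sup>2 * norm y) * (\<rho> / \<sigma>) ^ n" for n
  proof -
    have "- 2 - int n = - int (n + 2)" by simp
    then have bound: "norm (Rc (- 2 - int n)) \<le> C * \<rho> ^ (n + 2)"
      using C(2)[of "n + 2"] by (simp only:)
    have "norm (Rc 0 (A1 (Rc (- 2) y))) = norm (Rc (int n) (A1 (Rc (- 2 - int n) y)))"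
      by (simp add: shift)
    also have "\<dots> \<le> norm (Rc (int n)) * (norm A1 * (norm (Rc (- 2 - int n)) * norm y))"
      by (meson norm_blinfun order_trans mult_left_mono norm_ge_zero)
    also have "\<dots> \<le> (D * (1 / \<sigma>) ^ n) * (norm A1 * ((C * \<rho> ^ (n + 2)) * norm y))"
      using D C(1) pos bound by (intro mult_mono mult_left_mono mult_right_mono) simp_all
    also have "\<dots> = (D * norm A1 * C * \<rho>\<^sup>2 * norm y) * (\<rho> / \<sigma>) ^ n"
      by (simp add: power_add power_divide power2_eq_square)
    finally show ?thesis .
  qed
  then show ?thesis
    using pos \<sigma>(2) by (intro eq_0_if_norm_le_geometric[of "\<rho> / \<sigma>"]) (auto intro: always_eventually)
qed

text \<open>In the left equation at index 0 for the vector \<open>Rc (- 1) y\<close>, the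
  \<open>A0\<close> summand is the negative of the cross term and vanishes. Idempotence of both key
  projections follows.\<close>

lemma Rc_A1_Rc: "Rc (- 1) (A1 (Rc (- 1) y)) = Rc (- 1) y"
  using left_equation[of 0 "Rc (- 1) y"] A0_Rc_shift[of "- 1" y] cross_term_eq_0[of y]
  by (simp add: blinfun.minus_right)

section \<open>Chains and their starting vectors\<close>

lemma singular_chain_projection: "singular_chain A0 A1 s (\<lambda>n. Rc (- int n) (A1 x))"
  unfolding singular_chain_def
proof (intro conjI allI impI limsup_le_s)
  fix n :: nat assume "n \<ge> 1"
  then have "A0 (Rc (- int n) (A1 x)) + A1 (Rc (- int n - 1) (A1 x)) = 0"
    using right_equation[of "- int n" "A1 x"] by simp
  moreover have "- int (Suc n) = - int n - 1" by simp
  ultimately show "A0 (Rc (- int n) (A1 x)) + A1 (Rc (- int (Suc n)) (A1 x)) = 0"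
    by (simp only:)
next
  fix \<rho> assume \<rho>: "s < \<rho>" "ereal \<rho> < r"
  then obtain C where C: "C > 0" "\<And>n. norm (Rc (- int n)) \<le> C * \<rho> ^ n"
    using coeff_bound_nonpos by blast
  have "\<rho> > 0" using \<rho>(1) s_nonneg by simp
  \<comment> \<open>The added 1 keeps the constant positive when \<open>A1 x = 0\<close>, as
    \<open>limsup_root_le\<close> demands.\<close>
  have "norm (Rc (- int n) (A1 x)) \<le> (C * (norm (A1 x) + 1)) * \<rho> ^ n" for n
  proof -
    have "norm (Rc (- int n) (A1 x)) \<le> norm (Rc (- int n)) * norm (A1 x)" by (rule norm_blinfun)
    also have "\<dots> \<le> (C * \<rho> ^ n) * (norm (A1 x) + 1)"
      using C \<open>\<rho> > 0\<close> by (intro mult_mono) simp_all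
    finally show ?thesis by (simp add: mult_ac)
  qed
  moreover have "C * (norm (A1 x) + 1) > 0"
    using C(1) norm_ge_zero[of "A1 x"] by (intro mult_pos_pos) linarith+
  ultimately show "limsup (\<lambda>n. ereal (root n (norm (Rc (- int n) (A1 x))))) \<le> ereal \<rho>"
    using \<open>\<rho> > 0\<close> by (intro limsup_root_le) auto
qed

text \<open>The index is \<open>n - 1\<close> because the chain starts at \<open>n = 1\<close>,
  where its value must be \<open>Rc 0 (A0 x)\<close>. The chain equation is the right equation at
  index \<open>n\<close>, nonzero there.\<close>

lemma regular_chain_projection: "regular_chain A0 A1 r (\<lambda>n. Rc (int n - 1) (A0 x))"
  unfolding regular_chain_def
proof (intro conjI allI impI limsup_le_inverse_r)
  fix n :: nat assume "n \<ge> 1"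
  then show "A1 (Rc (int n - 1) (A0 x)) + A0 (Rc (int (Suc n) - 1) (A0 x)) = 0"
    using right_equation[of "int n" "A0 x"] by (simp add: algebra_simps)
next
  fix \<rho> assume \<rho>: "s < \<rho>" "ereal \<rho> < r"
  then obtain C where C: "C > 0" "\<And>n. norm (Rc (int n)) \<le> C * (1 / \<rho>) ^ n"
    using coeff_bound_nonneg by blast
  have "\<rho> > 0" using \<rho>(1) s_nonneg by simp
  \<comment> \<open>The extra factor \<open>\<rho>\<close> compensates for the exponent
    \<open>n - 1\<close>. At \<open>n = 0\<close> the coefficient would be \<open>Rc (- 1)\<close>,
    which the bound in use does not cover.\<close>
  have "norm (Rc (int n - 1) (A0 x)) \<le> (C * \<rho> * (norm (A0 x) + 1)) * (1 / \<rho>) ^ n" if n: "n \<ge> 1" for n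
  proof -
    obtain m where m: "n = Suc m" using n by (cases n) simp_all
    have "norm (Rc (int n - 1) (A0 x)) \<le> norm (Rc (int m)) * norm (A0 x)"
      using norm_blinfun[of "Rc (int m)"] by (simp add: m)
    also have "\<dots> \<le> (C * (1 / \<rho>) ^ m) * (norm (A0 x) + 1)"
      using C \<open>\<rho> > 0\<close> by (intro mult_mono) simp_all
    finally show ?thesis using \<open>\<rho> > 0\<close> by (simp add: m mult_ac)
  qed
  moreover have "C * \<rho> * (norm (A0 x) + 1) > 0"
    using C(1) \<open>\<rho> > 0\<close> norm_ge_zero[of "A0 x"] by (intro mult_pos_pos) linarith+
  ultimately show "limsup (\<lambda>n. ereal (root n (norm (Rc (int n - 1) (A0 x))))) \<le> ereal (1 / \<rho>)"
    using \<open>\<rho> > 0\<close> by (intro limsup_root_le) auto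
qed

lemma singular_chain_start:
  assumes "singular_chain A0 A1 s x"
  shows "Rc 0 (A0 (x 1)) = 0"
proof -
  have chain: "A0 (x n) = - A1 (x (Suc n))" if "n \<ge> 1" for n
    using assms that by (simp add: singular_chain_def eq_neg_iff_add_eq_0)
  have shift: "Rc (int n) (A0 (x (Suc n))) = Rc 0 (A0 (x 1))" for n
  proof (induction n)
    case (Suc n)
    have "Rc (int (Suc n)) (A0 (x (Suc (Suc n)))) = - Rc (int n) (A1 (x (Suc (Suc n))))"
      using Rc_A0_shift[of "int (Suc n)"] by simp
    also have "\<dots> = Rc (int n) (A0 (x (Suc n)))"
      using chain[of "Suc n"] by (simp add: blinfun.minus_right)
    finally show ?case using Suc by simp
  qed simp
  obtain \<rho> where \<rho>: "s < \<rho>" "ereal \<rho> < r" using radius_between[OF s_less_r] by blast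
  \<comment> \<open>The chain is eventually at most \<open>\<rho> ^ n\<close> since
    \<open>\<rho>\<close> exceeds \<open>s\<close> strictly. Taking the coefficients on the larger
    circle makes the constant product decay like \<open>(\<rho> / \<sigma>) ^ n\<close>.\<close>
  obtain \<sigma> where \<sigma>: "s < \<sigma>" "\<rho> < \<sigma>" "ereal \<sigma> < r" using radius_between[OF \<rho>(2)] by blast
  obtain D where D: "D > 0" "\<And>n. norm (Rc (int n)) \<le> D * (1 / \<sigma>) ^ n"
    using coeff_bound_nonneg[OF \<sigma>(1,3)] by blast
  have pos: "\<rho> > 0" "\<sigma> > 0" using \<rho>(1) \<sigma>(1) s_nonneg by simp_all
  have "limsup (\<lambda>n. ereal (root n (norm (x n)))) < ereal \<rho>"
    using assms \<rho>(1) by (auto simp: singular_chain_def intro: order.strict_trans1)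
  from limsup_root_lessD[OF this]
  have "\<forall>\<^sub>F n in sequentially. norm (x (Suc n)) \<le> \<rho> ^ Suc n"
    by (simp only: eventually_sequentially_Suc[of "\<lambda>n. norm (x n) \<le> \<rho> ^ n"])
  then have "\<forall>\<^sub>F n in sequentially. norm (Rc 0 (A0 (x 1))) \<le> (D * norm A0 * \<rho>) * (\<rho> / \<sigma>) ^ n"
  proof eventually_elim
    case (elim n)
    have "norm (Rc 0 (A0 (x 1))) = norm (Rc (int n) (A0 (x (Suc n))))" by (simp add: shift)
    also have "\<dots> \<le> norm (Rc (int n)) * (norm A0 * norm (x (Suc n)))"
      by (meson norm_blinfun order_trans mult_left_mono norm_ge_zero)
    also have "\<dots> \<le> (D * (1 / \<sigma>) ^ n) * (norm A0 * \<rho> ^ Suc n)"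
      using D elim pos by (intro mult_mono mult_left_mono) simp_all
    also have "\<dots> = (D * norm A0 * \<rho>) * (\<rho> / \<sigma>) ^ n" by (simp add: power_divide)
    finally show ?case .
  qed
  then show ?thesis
    using pos \<sigma>(2) by (intro eq_0_if_norm_le_geometric[of "\<rho> / \<sigma>"]) auto
qed

lemma regular_chain_start:
  assumes "regular_chain A0 A1 r x"
  shows "Rc (- 1) (A1 (x 1)) = 0"
proof -
  have chain: "A1 (x n) = - A0 (x (Suc n))" if "n \<ge> 1" for n
    using assms that by (simp add: regular_chain_def eq_neg_iff_add_eq_0)
  have shift: "Rc (- int (Suc n)) (A1 (x (Suc n))) = Rc (- 1) (A1 (x 1))" for n
  proof (induction n)
    case (Suc n)
    have "Rc (- int (Suc (Suc n))) (A1 (x (Suc (Suc n)))) = - Rc (- int (Suc n)) (A0 (x (Suc (Suc n))))"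
      using Rc_A0_shift[of "- int (Suc n)"] by (simp add: algebra_simps)
    also have "\<dots> = Rc (- int (Suc n)) (A1 (x (Suc n)))"
      using chain[of "Suc n"] by (simp add: blinfun.minus_right)
    finally show ?case using Suc by simp
  qed simp
  obtain \<rho> where \<rho>: "s < \<rho>" "ereal \<rho> < r" using radius_between[OF s_less_r] by blast
  obtain \<sigma> where \<sigma>: "s < \<sigma>" "\<rho> < \<sigma>" "ereal \<sigma> < r" using radius_between[OF \<rho>(2)] by blast
  obtain C where C: "C > 0" "\<And>n. norm (Rc (- int n)) \<le> C * \<rho> ^ n" using coeff_bound_nonpos[OF \<rho>] by blast
  have pos: "\<rho> > 0" "\<sigma> > 0" using \<rho>(1) \<sigma>(1) s_nonneg by simp_all
  \<comment> \<open>The radii exchange roles: the outer one now bounds the chain and the inner one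
    the coefficients of negative index.\<close>
  have "1 / r < ereal (1 / \<sigma>)"
    using \<sigma>(3) pos by (cases r) (auto simp: field_simps one_ereal_def)
  then have "limsup (\<lambda>n. ereal (root n (norm (x n)))) < ereal (1 / \<sigma>)"
    using assms by (auto simp: regular_chain_def intro: order.strict_trans1)
  from limsup_root_lessD[OF this]
  have "\<forall>\<^sub>F n in sequentially. norm (x (Suc n)) \<le> (1 / \<sigma>) ^ Suc n"
    by (simp only: eventually_sequentially_Suc[of "\<lambda>n. norm (x n) \<le> (1 / \<sigma>) ^ n"])
  then have "\<forall>\<^sub>F n in sequentially.
      norm (Rc (- 1) (A1 (x 1))) \<le> (C * norm A1 * (\<rho> / \<sigma>)) * (\<rho> / \<sigma>) ^ n"
  proof eventually_elim
    case (elim n)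
    have "norm (Rc (- 1) (A1 (x 1))) = norm (Rc (- int (Suc n)) (A1 (x (Suc n))))"
      by (simp only: shift)
    also have "\<dots> \<le> norm (Rc (- int (Suc n))) * (norm A1 * norm (x (Suc n)))"
      by (meson norm_blinfun order_trans mult_left_mono norm_ge_zero)
    also have "\<dots> \<le> (C * \<rho> ^ Suc n) * (norm A1 * (1 / \<sigma>) ^ Suc n)"
      using C(1) C(2)[of "Suc n"] elim pos by (intro mult_mono mult_left_mono) simp_all
    also have "\<dots> = (C * norm A1 * (\<rho> / \<sigma>)) * (\<rho> / \<sigma>) ^ n" by (simp add: power_divide)
    finally show ?case .
  qed
  then show ?thesis
    using pos \<sigma>(2) by (intro eq_0_if_norm_le_geometric[where q = "\<rho> / \<sigma>" and K = "C * norm A1 * (\<rho> / \<sigma>)"]) simp_all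
qed

section \<open>Generating subspaces and their images\<close>

lemma singular_generating_subspace_eq:
  "singular_generating_subspace A0 A1 s = range (Rc (- 1) o\<^sub>L A1)"
proof (intro equalityI subsetI)
  fix v assume "v \<in> singular_generating_subspace A0 A1 s"
  then have "Rc 0 (A0 v) = 0"
    using singular_chain_start by (auto simp: singular_generating_subspace_def)
  then have "v = (Rc (- 1) o\<^sub>L A1) v" by (simp add: Rc_0_A0)
  then show "v \<in> range (Rc (- 1) o\<^sub>L A1)" by blast
next
  fix v assume "v \<in> range (Rc (- 1) o\<^sub>L A1)"
  then obtain x where "v = (\<lambda>n. Rc (- int n) (A1 x)) 1" by auto
  then show "v \<in> singular_generating_subspace A0 A1 s"
    using singular_chain_projection[of x] unfolding singular_generating_subspace_def
    by (intro CollectI exI conjI)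
qed

lemma regular_generating_subspace_eq:
  "regular_generating_subspace A0 A1 r = range (Rc 0 o\<^sub>L A0)"
proof (intro equalityI subsetI)
  fix v assume "v \<in> regular_generating_subspace A0 A1 r"
  then have "Rc (- 1) (A1 v) = 0"
    using regular_chain_start by (auto simp: regular_generating_subspace_def)
  then have "v = (Rc 0 o\<^sub>L A0) v" by (simp add: Rc_0_A0)
  then show "v \<in> range (Rc 0 o\<^sub>L A0)" by blast
next
  fix v assume "v \<in> range (Rc 0 o\<^sub>L A0)"
  then obtain x where "v = (\<lambda>n. Rc (int n - 1) (A0 x)) 1" by auto
  then show "v \<in> regular_generating_subspace A0 A1 r"
    using regular_chain_projection[of x] unfolding regular_generating_subspace_def
    by (intro CollectI exI conjI)
qed

lemma Rc_0_complement: "id_blinfun - (Rc (- 1) o\<^sub>L A1) = Rc 0 o\<^sub>L A0"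
  by (rule blinfun_eqI) (simp add: blinfun.diff_left Rc_0_A0)

lemma A0_complement: "id_blinfun - (A1 o\<^sub>L Rc (- 1)) = A0 o\<^sub>L Rc 0"
  by (rule blinfun_eqI) (simp add: blinfun.diff_left A0_Rc_0)

lemma domain_projection: "(Rc (- 1) o\<^sub>L A1) o\<^sub>L (Rc (- 1) o\<^sub>L A1) = Rc (- 1) o\<^sub>L A1"
  by (rule blinfun_eqI) (simp add: Rc_A1_Rc)

lemma range_projection: "(A1 o\<^sub>L Rc (- 1)) o\<^sub>L (A1 o\<^sub>L Rc (- 1)) = A1 o\<^sub>L Rc (- 1)"
  by (rule blinfun_eqI) (simp add: Rc_A1_Rc)

text \<open>With \<open>P = Rc (- 1) o\<^sub>L A1\<close>, the nontrivial inclusion is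
  \<open>Rc (- 1) = P o\<^sub>L Rc (- 1)\<close>: the preimage \<open>Rc (- 1) y\<close> already
  lies in the range of \<open>P\<close>.\<close>

lemma A1_image_singular: "A1 ` range (Rc (- 1) o\<^sub>L A1) = range (A1 o\<^sub>L Rc (- 1))"
proof (intro equalityI subsetI)
  fix v assume "v \<in> range (A1 o\<^sub>L Rc (- 1))"
  then obtain y where "v = A1 ((Rc (- 1) o\<^sub>L A1) (Rc (- 1) y))" by (auto simp: Rc_A1_Rc)
  then show "v \<in> A1 ` range (Rc (- 1) o\<^sub>L A1)" by blast
qed auto

text \<open>Idempotence of \<open>A0 o\<^sub>L Rc 0\<close>, inherited from its complement, lets
  \<open>Rc 0 y\<close> be replaced by its projection \<open>Rc 0 (A0 (Rc 0 y))\<close> without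
  changing the image under \<open>A0\<close>.\<close>

lemma A0_image_regular: "A0 ` range (Rc 0 o\<^sub>L A0) = range (A0 o\<^sub>L Rc 0)"
proof (intro equalityI subsetI)
  fix v assume "v \<in> range (A0 o\<^sub>L Rc 0)"
  then obtain y where "v = A0 (Rc 0 y)" by auto
  moreover have "A0 (Rc 0 (A0 (Rc 0 y))) = A0 (Rc 0 y)"
    by (simp add: A0_Rc_0 blinfun.diff_right Rc_A1_Rc)
  ultimately have "v = A0 ((Rc 0 o\<^sub>L A0) (Rc 0 y))" by simp
  then show "v \<in> A0 ` range (Rc 0 o\<^sub>L A0)" by blast
qed auto

lemma clinear_domain_projection: "clinear (Rc (- 1) o\<^sub>L A1)"
  and clinear_range_projection: "clinear (A1 o\<^sub>L Rc (- 1))"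
  unfolding clinear_blinfun_iff by (simp_all add: scaleC_Rc scaleC1)

end

theorem theorem1:
  fixes A0 A1 :: "'x::complex_banach \<Rightarrow>\<^sub>L 'y::complex_banach"
    and R :: "complex \<Rightarrow> 'y \<Rightarrow>\<^sub>L 'x"
    and Rc :: "int \<Rightarrow> 'y \<Rightarrow>\<^sub>L 'x"
    and s :: real and r :: ereal
  assumes "clinear A0" and "clinear A1"
    and "0 \<le> s" and "ereal s < r"
    and "is_resolvent_on A0 A1 R (annulus s r)"
    and "vector_analytic_on R (annulus s r)"
    and "is_laurent_series_on Rc R (annulus s r)"
  defines "P \<equiv> Rc (-1) o\<^sub>L A1"
  defines "Pc \<equiv> id_blinfun - P"
  defines "Q \<equiv> A1 o\<^sub>L Rc (-1)"
  defines "Qc \<equiv> id_blinfun - Q"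
  defines "Xs \<equiv> singular_generating_subspace A0 A1 s"
  defines "Xr \<equiv> regular_generating_subspace A0 A1 r"
  defines "Ys \<equiv> range Q"
  defines "Yr \<equiv> range Qc"
  shows "(P o\<^sub>L P = P \<and> Pc = Rc 0 o\<^sub>L A0 \<and> Q o\<^sub>L Q = Q \<and> Qc = A0 o\<^sub>L Rc 0) \<and>
    (Xs = range P \<and> Xr = range Pc \<and> topological_direct_sum Xs Xr) \<and>
    (Ys = A1 ` Xs \<and> Yr = A0 ` Xr \<and> topological_direct_sum Ys Yr)"
proof -
  interpret pencil_resolvent A0 A1 R Rc s r
    by (rule pencil_resolvent.intro) (fact assms)+
  show ?thesis
    unfolding P_def Pc_def Q_def Qc_def Xs_def Xr_def Ys_def Yr_def
    using topological_direct_sum_projection[OF clinear_domain_projection domain_projection]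
      topological_direct_sum_projection[OF clinear_range_projection range_projection]
    by (simp only: singular_generating_subspace_eq regular_generating_subspace_eq simp_thms
        Rc_0_complement A0_complement domain_projection range_projection
        A1_image_singular A0_image_regular)
qed

end
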